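(* For every $(a,b,c)\in\mathbb R^3$, $$(a,b,c)\in\mathsf B_{\mathfrak O}\quad\Longleftrightarrow\quad (a,c)\in[-1,1]^2\ \text{ and }\ G(a,c)\le b\le F(a,c).$$ In particular, $F$ is concave, $G$ is convex, and both are continuous on $[-1,1]^2$.
   Context: Let $\tau=\sqrt2-1$ and $\mathfrak O=\{(x,y)\in[0,1]^2: x+y\le\sqrt2\}$. A triple $(a,b,c)\in\mathbb R^3$ is identified with the quadratic form $P(x,y)=ax^2+bxy+cy^2$, and $\|(a,b,c)\|_{\mathfrak O}=\sup\{|P(x,y)|:(x,y)\in\mathfrak O\}$. Let $\mathsf B_{\mathfrak O}=\{(a,b,c)\in\mathbb R^3:\|(a,b,c)\|_{\mathfrak O}\le1\}$. Define the regions $$\mathcal A=\{(a,c)\in[-1,1]^2:a\le0,\ 1+\tau^2a\le c\le1\},$$ $$\mathcal B=\{(a,c)\in[-1,1]^2:a\le c,\ \tau+\tau^2a\le c\le1+\tau^2a\},$$ $$\mathcal C=\{(a,c)\in[-1,1]^2:c\le\tau+\tau^2a,\ a\le\tau+\tau^2c\},$$ $$\mathcal D=\{(a,c)\in[-1,1]^2:c\le a,\ \tau+\tau^2c\le a\le1+\tau^2c\},$$ $$\mathcal E=\{(a,c)\in[-1,1]^2:c\le0,\ 1+\tau^2c\le a\le1\},$$ which cover $[-1,1]^2$, have pairwise disjoint interiors, and overlap only in boundary pieces. Define $F:[-1,1]^2\to\mathbb R$ by $$F(a,c)=\begin{cases}2\sqrt{-a(1-c)},&(a,c)\in\mathcal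 A,\\ \dfrac{1-c}{\tau}-\tau a,&(a,c)\in\mathcal B,\\ 1+\sqrt{(1-2a)(1-2c)},&(a,c)\in\mathcal C,\\ \dfrac{1-a}{\tau}-\tau c,&(a,c)\in\mathcal D,\\ 2\sqrt{-c(1-a)},&(a,c)\in\mathcal E;\end{cases}$$ the formulas agree on all overlaps, so $F$ is well defined. Define $G:[-1,1]^2\to\mathbb R$ by $G(a,c)=-F(-a,-c)$. *)

theory Defs
  imports "HOL-Analysis.Analysis"
begin

definition tau :: real where
  "tau = sqrt 2 - 1"

definition octagon :: "(real \<times> real) set" where
  "octagon = {(x, y). x \<in> {0..1} \<and> y \<in> {0..1} \<and> x + y \<le> sqrt 2}"

fun qform :: "real \<times> real \<times> real \<Rightarrow> real \<times> real \<Rightarrow> real" where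
  "qform (a, b, c) (x, y) = a * x\<^sup>2 + b * x * y + c * y\<^sup>2"

text \<open>The supremum is a genuine one: \<^const>\<open>octagon\<close> is nonempty and compact.\<close>

definition octagon_norm :: "real \<times> real \<times> real \<Rightarrow> real" where
  "octagon_norm p = (SUP z\<in>octagon. \<bar>qform p z\<bar>)"

definition octagon_ball :: "(real \<times> real \<times> real) set" where
  "octagon_ball = {p. octagon_norm p \<le> 1}"

definition square :: "(real \<times> real) set" where
  "square = {-1..1} \<times> {-1..1}"

definition region_A :: "(real \<times> real) set" where
  "region_A = {(a, c) \<in> square. a \<le> 0 \<and> 1 + tau\<^sup>2 * a \<le> c \<and> c \<le> 1}"

definition region_B :: "(real \<times> real) set" where
  "region_B = {(a, c) \<in> square. a \<le> c \<and> tau + tau\<^sup>2 * a \<le> c \<and> c \<le> 1 + tau\<^sup>2 * a}"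

definition region_C :: "(real \<times> real) set" where
  "region_C = {(a, c) \<in> square. c \<le> tau + tau\<^sup>2 * a \<and> a \<le> tau + tau\<^sup>2 * c}"

definition region_D :: "(real \<times> real) set" where
  "region_D = {(a, c) \<in> square. c \<le> a \<and> tau + tau\<^sup>2 * c \<le> a \<and> a \<le> 1 + tau\<^sup>2 * c}"

definition region_E :: "(real \<times> real) set" where
  "region_E = {(a, c) \<in> square. c \<le> 0 \<and> 1 + tau\<^sup>2 * c \<le> a \<and> a \<le> 1}"

text \<open>
  The regions cover \<^const>\<open>square\<close>, and the five formulas agree on all overlaps, so the
  order of the case distinction is immaterial; see \<open>regions_cover\<close> and \<open>F_eqs\<close> below.
  Outside \<^const>\<open>square\<close> the value of \<open>F\<close> is unspecified.
\<close>

fun F :: "real \<times> real \<Rightarrow> real" where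
  "F (a, c) =
    (if (a, c) \<in> region_A then 2 * sqrt (- a * (1 - c))
     else if (a, c) \<in> region_B then (1 - c) / tau - tau * a
     else if (a, c) \<in> region_C then 1 + sqrt ((1 - 2 * a) * (1 - 2 * c))
     else if (a, c) \<in> region_D then (1 - a) / tau - tau * c
     else if (a, c) \<in> region_E then 2 * sqrt (- c * (1 - a))
     else undefined)"

declare F.simps [simp del]

fun G :: "real \<times> real \<Rightarrow> real" where
  "G (a, c) = - F (- a, - c)"

lemma tau_pos: "0 < tau" and tau_sq: "tau\<^sup>2 = 1 - 2 * tau" and tau_less: "tau < 1/2"
proof -
  have "1 < sqrt 2" by simp
  then show "0 < tau" unfolding tau_def by linarith
  show "tau\<^sup>2 = 1 - 2 * tau"
    by (simp add: tau_def power2_diff)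
  have "sqrt 2 < 3/2" by (rule real_less_lsqrt) (auto simp: power2_eq_square)
  then show "tau < 1/2" unfolding tau_def by linarith
qed

lemma tau_sq_bounds: "0 < tau\<^sup>2" "tau\<^sup>2 < 1"
  using tau_pos tau_less tau_sq by auto

lemma regions_cover: "square = region_A \<union> region_B \<union> region_C \<union> region_D \<union> region_E"
proof
  show "square \<subseteq> region_A \<union> region_B \<union> region_C \<union> region_D \<union> region_E"
  proof
    fix p assume p: "p \<in> square"
    obtain a c where ac: "p = (a, c)" by force
    have b: "-1 \<le> a" "a \<le> 1" "-1 \<le> c" "c \<le> 1" using p by (auto simp: ac square_def)
    have "a \<le> 0" if "1 + tau\<^sup>2 * a \<le> c"
    proof -
      have "tau\<^sup>2 * a \<le> 0" using that b by linarith
      then show ?thesis using tau_sq_bounds by (simp add: mult_le_0_iff)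
    qed
    moreover have "c \<le> 0" if "1 + tau\<^sup>2 * c \<le> a"
    proof -
      have "tau\<^sup>2 * c \<le> 0" using that b by linarith
      then show ?thesis using tau_sq_bounds by (simp add: mult_le_0_iff)
    qed
    moreover have False
      if "a \<le> c" "c \<le> tau + tau\<^sup>2 * a" "tau + tau\<^sup>2 * c < a"
    proof -
      have "tau\<^sup>2 * a \<le> tau\<^sup>2 * c" using that tau_sq_bounds by (simp add: mult_left_mono)
      then show False using that by linarith
    qed
    moreover have False
      if "c \<le> a" "a \<le> tau + tau\<^sup>2 * c" "tau + tau\<^sup>2 * a < c"
    proof -
      have "tau\<^sup>2 * c \<le> tau\<^sup>2 * a" using that tau_sq_bounds by (simp add: mult_left_mono)
      then show False using that by linarith
    qed
    ultimately show "p \<in> region_A \<union> region_B \<union> region_C \<union> region_D \<union> region_E"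
      using p b unfolding ac region_A_def region_B_def region_C_def region_D_def region_E_def
      by simp argo
  qed
qed (auto simp: region_A_def region_B_def region_C_def region_D_def region_E_def)

lemma overlap_AB:
  assumes "a \<le> 0" "c = 1 + tau\<^sup>2 * a"
  shows "2 * sqrt (- a * (1 - c)) = (1 - c) / tau - tau * a"
proof -
  have "- a * (1 - c) = (tau * (- a))\<^sup>2"
    by (simp add: assms(2) power2_eq_square)
  moreover have "0 \<le> tau * (- a)"
    by (rule mult_nonneg_nonneg) (use tau_pos assms(1) in auto)
  ultimately have "sqrt (- a * (1 - c)) = tau * (- a)"
    by (simp only: real_sqrt_abs abs_of_nonneg)
  moreover have "(1 - c) / tau = - tau * a"
    using tau_pos by (simp add: assms(2) power2_eq_square)
  ultimately show ?thesis by simp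
qed

lemma overlap_BC:
  assumes "a \<le> c" "c = tau + tau\<^sup>2 * a"
  shows "(1 - c) / tau - tau * a = 1 + sqrt ((1 - 2 * a) * (1 - 2 * c))"
proof -
  have "tau * (2 * a) \<le> tau * 1"
    using assms by (simp add: tau_sq algebra_simps)
  then have "2 * a \<le> 1" using tau_pos by (simp only: mult_le_cancel_left_pos)
  then have nn: "0 \<le> tau * (1 - 2 * a)" using tau_pos by simp
  have "1 - 2 * c = tau\<^sup>2 * (1 - 2 * a)"
    using tau_sq by (simp add: assms(2) algebra_simps)
  then have "(1 - 2 * a) * (1 - 2 * c) = (tau * (1 - 2 * a))\<^sup>2"
    by (simp add: power2_eq_square)
  then have "sqrt ((1 - 2 * a) * (1 - 2 * c)) = tau * (1 - 2 * a)"
    using nn by (simp only: real_sqrt_abs abs_of_nonneg)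
  moreover have "1 - c = tau * (1 + tau - tau * a)"
    using tau_sq by (simp add: assms(2) power2_eq_square algebra_simps)
  then have "(1 - c) / tau = 1 + tau - tau * a"
    using tau_pos by simp
  ultimately show ?thesis by (simp add: algebra_simps)
qed

lemma F_eqs:
  "(a, c) \<in> region_A \<Longrightarrow> F (a, c) = 2 * sqrt (- a * (1 - c))"
  "(a, c) \<in> region_B \<Longrightarrow> F (a, c) = (1 - c) / tau - tau * a"
  "(a, c) \<in> region_C \<Longrightarrow> F (a, c) = 1 + sqrt ((1 - 2 * a) * (1 - 2 * c))"
  "(a, c) \<in> region_D \<Longrightarrow> F (a, c) = (1 - a) / tau - tau * c"
  "(a, c) \<in> region_E \<Longrightarrow> F (a, c) = 2 * sqrt (- c * (1 - a))"
proof -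
  have small: "-1 < tau\<^sup>2 * x" if "-1 \<le> x" for x
    using mult_left_mono[OF that, of "tau\<^sup>2"] tau_sq_bounds by linarith
  note sq = square_def mem_Times_iff
  note defs = region_A_def region_B_def region_C_def region_D_def region_E_def
  have AB: "2 * sqrt (- a * (1 - c)) = (1 - c) / tau - tau * a"
    if "(a, c) \<in> region_A" "(a, c) \<in> region_B"
    using that overlap_AB[of a c] by (auto simp: defs)
  have BC: "(1 - c) / tau - tau * a = 1 + sqrt ((1 - 2 * a) * (1 - 2 * c))"
    if "(a, c) \<in> region_B" "(a, c) \<in> region_C"
    using that overlap_BC[of a c] by (auto simp: defs)
  have BD: "(1 - c) / tau - tau * a = (1 - a) / tau - tau * c"
    if "(a, c) \<in> region_B" "(a, c) \<in> region_D"
    using that by (auto simp: defs)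
  have CD: "1 + sqrt ((1 - 2 * a) * (1 - 2 * c)) = (1 - a) / tau - tau * c"
    if "(a, c) \<in> region_C" "(a, c) \<in> region_D"
    using that overlap_BC[of c a] by (auto simp: defs mult.commute)
  have DE: "(1 - a) / tau - tau * c = 2 * sqrt (- c * (1 - a))"
    if "(a, c) \<in> region_D" "(a, c) \<in> region_E"
    using that overlap_AB[of c a] by (auto simp: defs)
  have AC: False if "(a, c) \<in> region_A" "(a, c) \<in> region_C"
    using that tau_less by (auto simp: defs)
  have CE: False if "(a, c) \<in> region_C" "(a, c) \<in> region_E"
    using that tau_less by (auto simp: defs)
  have AD: False if "(a, c) \<in> region_A" "(a, c) \<in> region_D"
    using that small[of a] by (auto simp: defs sq)
  have AE: False if "(a, c) \<in> region_A" "(a, c) \<in> region_E"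
    using that small[of a] by (auto simp: defs sq)
  have BE: False if "(a, c) \<in> region_B" "(a, c) \<in> region_E"
    using that small[of c] by (auto simp: defs sq)
  show "(a, c) \<in> region_A \<Longrightarrow> F (a, c) = 2 * sqrt (- a * (1 - c))"
    by (simp add: F.simps)
  show "(a, c) \<in> region_B \<Longrightarrow> F (a, c) = (1 - c) / tau - tau * a"
    using AB by (simp add: F.simps)
  show "(a, c) \<in> region_C \<Longrightarrow> F (a, c) = 1 + sqrt ((1 - 2 * a) * (1 - 2 * c))"
    using AC BC by (auto simp: F.simps)
  show "(a, c) \<in> region_D \<Longrightarrow> F (a, c) = (1 - a) / tau - tau * c"
    using AD BD CD by (auto simp: F.simps)
  show "(a, c) \<in> region_E \<Longrightarrow> F (a, c) = 2 * sqrt (- c * (1 - a))"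
    using AE BE CE DE by (auto simp: F.simps)
qed

end

(* Over the square, the forms with P <= 1 on the octagon are bounded above in b by the infimum of
   (1 - a x^2 - c y^2) / (x y), which by homogeneity is approached on the three outer edges y = 1,
   x + y = sqrt 2 and x = 1.  Depending on the region the infimum sits on an edge (A, C, E, where
   the extremal P is y^2, (x + y)^2 / 2 or x^2 minus a square) or at a vertex (B, D).  The bound P >= -1 follows by passing
   to -P, and F is concave because its hypograph is cut out by conditions linear in (a, b, c). *)
theory Submission
  imports Defs
begin

section \<open>Octagon and square: elementary facts\<close>

lemma sqrt_2_eq_tau: "sqrt 2 = 1 + tau"
  by (simp add: tau_def)

lemma mem_octagon_iff:
  "(x, y) \<in> octagon \<longleftrightarrow> 0 \<le> x \<and> x \<le> 1 \<and> 0 \<le> y \<and> y \<le> 1 \<and> x + y \<le> sqrt 2"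
  by (auto simp: octagon_def)

lemma mem_square_iff: "(a, c) \<in> square \<longleftrightarrow> -1 \<le> a \<and> a \<le> 1 \<and> -1 \<le> c \<and> c \<le> 1"
  by (auto simp: square_def)

lemma octagon_swap: "(x, y) \<in> octagon \<longleftrightarrow> (y, x) \<in> octagon"
  by (auto simp: octagon_def)

text \<open>Each outer edge contributes the square of its linear functional. These are the forms
  against which the quadratic form is compared below.\<close>

lemma octagon_bounds:
  assumes "(x, y) \<in> octagon"
  shows "x\<^sup>2 \<le> 1" "y\<^sup>2 \<le> 1" "(x + y)\<^sup>2 \<le> 2"
proof -
  show "x\<^sup>2 \<le> 1" "y\<^sup>2 \<le> 1" using assms by (auto simp: mem_octagon_iff power_le_one)
  have "(x + y)\<^sup>2 \<le> (sqrt 2)\<^sup>2" using assms by (intro power_mono) (auto simp: mem_octagon_iff)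
  then show "(x + y)\<^sup>2 \<le> 2" by simp
qed

text \<open>On the line \<open>y = 1\<close> the constraint \<open>x + y \<le> sqrt 2\<close> reads
  \<open>x \<le> tau\<close>.\<close>

lemma top_edge_mem_octagon: "0 \<le> x \<Longrightarrow> x \<le> tau \<Longrightarrow> (x, 1) \<in> octagon"
  using tau_less by (auto simp: mem_octagon_iff sqrt_2_eq_tau)

section \<open>Upper bounds for the extremal forms\<close>

text \<open>With \<open>p\<close> and \<open>q\<close> the roots of \<open>- a\<close> and
  \<open>1 - c\<close>, completing the square turns the form into
  \<open>y\<^sup>2 - (p * x - q * y)\<^sup>2\<close>.\<close>

lemma form_le_one_A:
  assumes "(a, c) \<in> region_A" "(x, y) \<in> octagon"
  shows "a * x\<^sup>2 + 2 * sqrt (- a * (1 - c)) * x * y + c * y\<^sup>2 \<le> 1"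
proof -
  define p q where "p = sqrt (- a)" and "q = sqrt (1 - c)"
  have "p\<^sup>2 = - a" "q\<^sup>2 = 1 - c" using assms(1) by (auto simp: p_def q_def region_A_def)
  then have a: "a = - p\<^sup>2" and c: "c = 1 - q\<^sup>2" by auto
  have s: "sqrt (- a * (1 - c)) = p * q" by (simp add: p_def q_def flip: real_sqrt_mult)
  have "a * x\<^sup>2 + 2 * sqrt (- a * (1 - c)) * x * y + c * y\<^sup>2 = y\<^sup>2 - (p * x - q * y)\<^sup>2"
    unfolding s by (simp add: a c power2_eq_square algebra_simps)
  also have "\<dots> \<le> y\<^sup>2" by simp
  also have "\<dots> \<le> 1" using octagon_bounds[OF assms(2)] by simp
  finally show ?thesis .
qed

text \<open>The inequalities of region C, restated in \<open>1 - 2 * a\<close> and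
  \<open>1 - 2 * c\<close> by means of \<open>tau_sq\<close>. Their sum shows that
  \<open>(1 - 2 * a) + (1 - 2 * c)\<close> is nonnegative, and then each summand is; hence both have
  real square roots.\<close>

lemma region_C_bounds:
  assumes "(a, c) \<in> region_C"
  shows "tau\<^sup>2 * (1 - 2 * a) \<le> 1 - 2 * c" "tau\<^sup>2 * (1 - 2 * c) \<le> 1 - 2 * a"
    "a \<le> 1 / 2" "c \<le> 1 / 2"
proof -
  show *: "tau\<^sup>2 * (1 - 2 * a) \<le> 1 - 2 * c" "tau\<^sup>2 * (1 - 2 * c) \<le> 1 - 2 * a"
  proof -
    have "tau\<^sup>2 * (1 - 2 * x) = 1 - 2 * (tau + tau\<^sup>2 * x)" for x
      using tau_sq by algebra
    then show "tau\<^sup>2 * (1 - 2 * a) \<le> 1 - 2 * c" "tau\<^sup>2 * (1 - 2 * c) \<le> 1 - 2 * a"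
      using assms by (auto simp: region_C_def)
  qed
  have "(1 - tau\<^sup>2) * 0 \<le> (1 - tau\<^sup>2) * ((1 - 2 * a) + (1 - 2 * c))"
    using * by (simp add: algebra_simps)
  then have sum: "0 \<le> (1 - 2 * a) + (1 - 2 * c)"
    using tau_sq_bounds by (simp only: mult_le_cancel_left_pos)
  have "0 \<le> u" if "tau\<^sup>2 * v \<le> u" "0 \<le> u + v" for u v
  proof (cases "0 \<le> v")
    case True
    then have "0 \<le> tau\<^sup>2 * v" by simp
    with that show ?thesis by simp
  qed (use that in simp)
  from this[OF *(1)] this[OF *(2)] sum show "a \<le> 1 / 2" "c \<le> 1 / 2" by auto
qed

text \<open>As in region A, but the square is now subtracted from
  \<open>(x + y)\<^sup>2 / 2\<close>, the comparison form of the diagonal edge.\<close>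

lemma form_le_one_C:
  assumes "(a, c) \<in> region_C" "(x, y) \<in> octagon"
  shows "a * x\<^sup>2 + (1 + sqrt ((1 - 2 * a) * (1 - 2 * c))) * x * y + c * y\<^sup>2 \<le> 1"
proof -
  define p q where "p = sqrt (1 - 2 * a)" and "q = sqrt (1 - 2 * c)"
  have "p\<^sup>2 = 1 - 2 * a" "q\<^sup>2 = 1 - 2 * c"
    using region_C_bounds[OF assms(1)] by (auto simp: p_def q_def)
  then have a: "a = (1 - p\<^sup>2) / 2" and c: "c = (1 - q\<^sup>2) / 2" by auto
  have s: "sqrt ((1 - 2 * a) * (1 - 2 * c)) = p * q" by (simp add: p_def q_def flip: real_sqrt_mult)
  have "a * x\<^sup>2 + (1 + sqrt ((1 - 2 * a) * (1 - 2 * c))) * x * y + c * y\<^sup>2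
      = (x + y)\<^sup>2 / 2 - (p * x - q * y)\<^sup>2 / 2"
    unfolding s by (simp add: a c power2_eq_square field_simps)
  also have "\<dots> \<le> (x + y)\<^sup>2 / 2" by simp
  also have "\<dots> \<le> 1" using octagon_bounds[OF assms(2)] by simp
  finally show ?thesis .
qed

lemma form_le_one_B:
  assumes "(a, c) \<in> region_B" "(x, y) \<in> octagon"
  shows "a * x\<^sup>2 + ((1 - c) / tau - tau * a) * x * y + c * y\<^sup>2 \<le> 1" (is "?P \<le> 1")
proof -
  have xy: "0 \<le> x" "0 \<le> y" using assms by (auto simp: mem_octagon_iff)
  have R: "-1 \<le> a" "a \<le> 1" "c \<le> 1" "a \<le> c" "tau + tau\<^sup>2 * a \<le> c" "c \<le> 1 + tau\<^sup>2 * a"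
    using assms by (auto simp: region_B_def mem_square_iff)
  have t: "0 < tau" "tau \<noteq> 0" using tau_pos by auto
  \<comment> \<open>Because \<open>tau * (2 + tau) = 1\<close>, the division by \<open>tau\<close>
    disappears and the identities below are polynomial modulo \<open>tau_sq\<close>.\<close>
  define r where "r = 1 / tau"
  have r: "r = 2 + tau" and rt: "r * tau = 1" and "0 < r"
    using t tau_sq by (auto simp: r_def field_simps power2_eq_square)
  have P: "?P = a * x\<^sup>2 + ((1 - c) * r - tau * a) * x * y + c * y\<^sup>2" by (simp add: r_def)
  have P': "?P = a * x\<^sup>2 + ((1 - c) * (2 + tau) - tau * a) * x * y + c * y\<^sup>2"
    unfolding P r ..
  \<comment> \<open>One sector per outer edge. The extremal form equals \<open>1\<close> at the vertex \<open>(tau, 1)\<close>, so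
    \<open>x - tau * y\<close> divides the gap in the first two sectors.\<close>
  consider (top) "x \<le> tau * y" | (diag) "tau * y \<le> x" "tau * x \<le> y" | (right) "y \<le> tau * x"
    by linarith
  then show ?thesis
  proof cases
    case top
    have id: "y\<^sup>2 - ?P = (y - (2 + tau) * x) * ((1 - c) * y + tau * a * x)"
      unfolding P' using tau_sq by algebra
    have 1: "0 \<le> y - (2 + tau) * x"
    proof -
      have "r * x \<le> r * (tau * y)" using top \<open>0 < r\<close> by (intro mult_left_mono) auto
      also have "\<dots> = y" by (simp add: rt flip: mult.assoc)
      finally show ?thesis by (simp add: r)
    qed
    have 2: "0 \<le> (1 - c) * y + tau * a * x"
    proof -
      \<comment> \<open>The expression is nondecreasing in \<open>y\<close> and
        \<open>y \<ge> r * x\<close>. At \<open>y = r * x\<close> its sign is given by the upper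
        bound on \<open>c\<close> in region B.\<close>
      have "0 \<le> (1 - c + tau\<^sup>2 * a) * (r * x)" using R xy \<open>0 < r\<close> by (intro mult_nonneg_nonneg) auto
      also have "\<dots> = (1 - c) * (r * x) + (r * tau) * (tau * a * x)"
        by (simp add: algebra_simps power2_eq_square)
      also have "\<dots> = (1 - c) * (r * x) + tau * a * x" by (simp add: rt)
      also have "\<dots> \<le> (1 - c) * y + tau * a * x"
        using R 1 by (intro add_right_mono mult_left_mono) (auto simp: r)
      finally show ?thesis .
    qed
    have "0 \<le> y\<^sup>2 - ?P" unfolding id by (rule mult_nonneg_nonneg[OF 1 2])
    then show ?thesis using octagon_bounds[OF assms(2)] by simp
  next
    case diag
    \<comment> \<open>The cofactor of \<open>x - tau * y\<close> is expanded in the linear forms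
      \<open>y - tau * x\<close> and \<open>x - tau * y\<close>, both nonnegative in this sector;
      \<open>1 - tau\<^sup>2\<close> is their determinant up to sign. The coefficients are
      nonnegative by the inequalities of region B.\<close>
    have id: "(1 - tau\<^sup>2) * ((x + y)\<^sup>2 / 2 - ?P)
        = (x - tau * y) * (r * ((c - tau - tau\<^sup>2 * a) * (y - tau * x)) + (c - a) * (x - tau * y))"
      unfolding P' r using tau_sq by algebra
    have "0 \<le> (1 - tau\<^sup>2) * ((x + y)\<^sup>2 / 2 - ?P)"
      unfolding id using R diag \<open>0 < r\<close> by (intro mult_nonneg_nonneg add_nonneg_nonneg) auto
    then have "0 \<le> (x + y)\<^sup>2 / 2 - ?P" using tau_sq_bounds by (simp only: zero_le_mult_iff) auto
    then show ?thesis using octagon_bounds(3)[OF assms(2)] by linarith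
  next
    case right
    have "tau\<^sup>2 * (-1) \<le> tau\<^sup>2 * a" using R by (intro mult_left_mono) auto
    moreover have "tau\<^sup>2 \<le> tau" using t tau_less by (simp add: power2_eq_square)
    ultimately have "0 \<le> c" using R by linarith
    \<comment> \<open>The gap is written as a sum of products of nonnegative factors; the last
      summand is where \<open>0 \<le> c\<close> enters.\<close>
    have id: "x\<^sup>2 - ?P = (r * (tau * x - y)) * x * (1 - a)
        + r * (x * y) * ((c - a) * (1 - tau\<^sup>2)) + c * y * (tau * x - y)"
      unfolding P' r using tau_sq by algebra
    have "0 \<le> x\<^sup>2 - ?P"
      unfolding id using R right xy \<open>0 < r\<close> \<open>0 \<le> c\<close> tau_sq_bounds
      by (intro mult_nonneg_nonneg add_nonneg_nonneg) auto
    then show ?thesis using octagon_bounds[OF assms(2)] by simp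
  qed
qed

section \<open>Sharpness: upper bounds on the middle coefficient\<close>

text \<open>For \<open>c < 1\<close> the form is tested at \<open>(q / p, 1)\<close>, where the
  subtracted square vanishes. The region inequality says \<open>q \<le> tau * p\<close>, so this
  point lies on the top edge.\<close>

lemma coeff_le_A:
  assumes R: "(a, c) \<in> region_A" and le: "\<forall>z\<in>octagon. qform (a, b, c) z \<le> 1"
  shows "b \<le> 2 * sqrt (- a * (1 - c))"
proof (cases "c = 1")
  case True
  \<comment> \<open>The infimum is not attained here: the minimising point degenerates to \<open>x = 0\<close>.\<close>
  have "\<not> 0 < b"
  proof
    assume "0 < b"
    \<comment> \<open>The bound \<open>tau\<close> keeps \<open>(x, 1)\<close> in the octagon; the
      bound \<open>b / 2\<close> together with \<open>a \<ge> -1\<close> makes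
      \<open>a * x + b\<close> positive.\<close>
    define x where "x = min tau (b / 2)"
    have x: "0 < x" "x \<le> tau" "x \<le> b / 2" using \<open>0 < b\<close> tau_pos by (auto simp: x_def)
    have "x * (a * x + b) \<le> 0"
      using bspec[OF le top_edge_mem_octagon[of x]] x True by (simp add: power2_eq_square algebra_simps)
    then have "a * x + b \<le> 0" using x by (simp add: mult_le_0_iff)
    moreover have "-1 * x \<le> a * x"
      using R x by (intro mult_right_mono) (auto simp: region_A_def mem_square_iff)
    ultimately show False using x \<open>0 < b\<close> by simp
  qed
  then show ?thesis using True by simp
next
  case False
  define p q where "p = sqrt (- a)" and "q = sqrt (1 - c)"
  have A: "a \<le> 0" "1 - c \<le> tau\<^sup>2 * (- a)" "c < 1"
    using R False by (auto simp: region_A_def)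
  then have "a \<noteq> 0" by auto
  then have pos: "0 < p" "0 < q" using A by (auto simp: p_def q_def)
  have "p\<^sup>2 = - a" "q\<^sup>2 = 1 - c" using A by (auto simp: p_def q_def)
  then have a: "a = - p\<^sup>2" and c: "c = 1 - q\<^sup>2" by auto
  have "q \<le> tau * p"
    using real_sqrt_le_mono[OF A(2)] tau_pos unfolding real_sqrt_mult p_def q_def by simp
  then have "(q / p, 1) \<in> octagon"
    using pos by (intro top_edge_mem_octagon) (auto simp: field_simps)
  from bspec[OF le this] have "b * (q / p) \<le> 2 * q\<^sup>2"
    using pos by (simp add: a c power_divide)
  then have "b \<le> 2 * (p * q)" using pos by (simp add: field_simps power2_eq_square)
  then show ?thesis by (simp add: p_def q_def flip: real_sqrt_mult)
qed

text \<open>This is the condition at the vertex \<open>(tau, 1)\<close>, solved for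
  \<open>b\<close>.\<close>

lemma coeff_le_B:
  assumes "\<forall>z\<in>octagon. qform (a, b, c) z \<le> 1"
  shows "b \<le> (1 - c) / tau - tau * a"
  using bspec[OF assms top_edge_mem_octagon[of tau]] tau_pos by (simp add: field_simps power2_eq_square)

text \<open>The subtracted square vanishes in the direction \<open>(q, p)\<close>, so the form is
  tested where that ray meets the diagonal edge.\<close>

lemma coeff_le_C:
  assumes R: "(a, c) \<in> region_C" and le: "\<forall>z\<in>octagon. qform (a, b, c) z \<le> 1"
  shows "b \<le> 1 + sqrt ((1 - 2 * a) * (1 - 2 * c))"
proof (cases "a = 1 / 2 \<or> c = 1 / 2")
  case True
  \<comment> \<open>If one root vanishes, so does the other, and the direction \<open>(q, p)\<close>
    is lost. The midpoint of the diagonal edge serves instead.\<close>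
  have "u = 1 / 2" if "tau\<^sup>2 * (1 - 2 * u) \<le> 1 - 2 * v" "v = 1 / 2" "u \<le> 1 / 2" for u v
  proof -
    have "tau\<^sup>2 * (1 - 2 * u) \<le> 0" using that by simp
    then show ?thesis using tau_sq_bounds \<open>u \<le> 1 / 2\<close> by (simp add: mult_le_0_iff)
  qed
  then have ac: "a = 1 / 2" "c = 1 / 2"
    using region_C_bounds[OF R] True by blast+
  have "(sqrt 2 / 2, sqrt 2 / 2) \<in> octagon"
    using tau_pos tau_less by (simp add: mem_octagon_iff sqrt_2_eq_tau)
  from bspec[OF le this] show ?thesis by (simp add: ac power_divide mult.assoc)
next
  case False
  note C = region_C_bounds[OF R]
  define p q where "p = sqrt (1 - 2 * a)" and "q = sqrt (1 - 2 * c)"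
  have pos: "0 < p" "0 < q" using C False by (auto simp: p_def q_def)
  have "p\<^sup>2 = 1 - 2 * a" "q\<^sup>2 = 1 - 2 * c" using C by (auto simp: p_def q_def)
  then have a: "a = (1 - p\<^sup>2) / 2" and c: "c = (1 - q\<^sup>2) / 2" by auto
  have pq: "tau * p \<le> q" "tau * q \<le> p"
    using real_sqrt_le_mono[OF C(1)] real_sqrt_le_mono[OF C(2)] tau_pos
    unfolding real_sqrt_mult p_def q_def by simp_all
  \<comment> \<open>Scaling by \<open>s\<close> puts \<open>(q, p)\<close> on the line
    \<open>x + y = sqrt 2\<close>. Since \<open>sqrt 2 = 1 + tau\<close>, the two bounds in
    \<open>pq\<close> say exactly that both coordinates are at most 1.\<close>
  define s where "s = sqrt 2 / (p + q)"
  have s: "0 < s" "s * (p + q) = sqrt 2" using pos by (auto simp: s_def)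
  have s2: "s\<^sup>2 * (p + q)\<^sup>2 = 2" by (metis s(2) power_mult_distrib real_sqrt_pow2 zero_le_numeral)
  have "(s * q, s * p) \<in> octagon"
  proof -
    have "s * q + s * p = sqrt 2" using s by (simp add: algebra_simps)
    moreover have "s * q \<le> 1" "s * p \<le> 1"
      using pos pq by (simp_all add: s_def sqrt_2_eq_tau pos_divide_le_eq algebra_simps)
    ultimately show ?thesis using s pos by (simp add: mem_octagon_iff)
  qed
  from bspec[OF le this] have "s\<^sup>2 * (a * q\<^sup>2 + b * q * p + c * p\<^sup>2) \<le> s\<^sup>2 * ((p + q)\<^sup>2 / 2)"
    using s2 by (simp add: algebra_simps power2_eq_square)
  then have "a * q\<^sup>2 + b * q * p + c * p\<^sup>2 \<le> (p + q)\<^sup>2 / 2" using s by simp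
  then have "b * (p * q) \<le> (1 + p * q) * (p * q)"
    by (simp add: a c algebra_simps power2_eq_square add_divide_distrib diff_divide_distrib)
  then have "b \<le> 1 + p * q" using pos by simp
  then show ?thesis by (simp add: p_def q_def flip: real_sqrt_mult)
qed

section \<open>Characterisation of the unit ball\<close>

lemma region_swap:
  "(a, c) \<in> region_D \<longleftrightarrow> (c, a) \<in> region_B" "(a, c) \<in> region_E \<longleftrightarrow> (c, a) \<in> region_A"
  by (auto simp: region_A_def region_B_def region_D_def region_E_def square_def)

text \<open>On the octagon \<open>x * y \<ge> 0\<close>, so the form is nondecreasing in
  \<open>b\<close> and only the extremal value \<open>b = F (a, c)\<close> has to be
  bounded.\<close>

lemma qform_le_one_iff_ABC:
  assumes "(a, c) \<in> region_A \<union> region_B \<union> region_C"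
  shows "(\<forall>z\<in>octagon. qform (a, b, c) z \<le> 1) \<longleftrightarrow> b \<le> F (a, c)"
proof
  assume le: "\<forall>z\<in>octagon. qform (a, b, c) z \<le> 1"
  show "b \<le> F (a, c)"
    using assms coeff_le_A[OF _ le] coeff_le_B[OF le] coeff_le_C[OF _ le] by (auto simp: F_eqs)
next
  assume b: "b \<le> F (a, c)"
  have "qform (a, b, c) (x, y) \<le> 1" if z: "(x, y) \<in> octagon" for x y
  proof -
    have "b * (x * y) \<le> F (a, c) * (x * y)"
      using b z by (intro mult_right_mono) (auto simp: mem_octagon_iff)
    then have "qform (a, b, c) (x, y) \<le> a * x\<^sup>2 + F (a, c) * x * y + c * y\<^sup>2"
      by (simp add: mult.assoc)
    also have "\<dots> \<le> 1"
      using assms form_le_one_A[OF _ z] form_le_one_B[OF _ z] form_le_one_C[OF _ z]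
      by (auto simp: F_eqs)
    finally show ?thesis .
  qed
  then show "\<forall>z\<in>octagon. qform (a, b, c) z \<le> 1" by auto
qed

text \<open>Exchanging \<open>x\<close> and \<open>y\<close> preserves the octagon and exchanges
  \<open>a\<close> and \<open>c\<close>, which carries regions D and E to B and A.\<close>

lemma qform_le_one_iff:
  assumes "(a, c) \<in> square"
  shows "(\<forall>z\<in>octagon. qform (a, b, c) z \<le> 1) \<longleftrightarrow> b \<le> F (a, c)"
proof (cases "(a, c) \<in> region_A \<union> region_B \<union> region_C")
  case False
  then have DE: "(a, c) \<in> region_D \<union> region_E" using assms regions_cover by blast
  have "F (a, c) = F (c, a)" using DE by (auto simp: F_eqs region_swap)
  moreover have "(\<forall>z\<in>octagon. qform (a, b, c) z \<le> 1) \<longleftrightarrow> (\<forall>z\<in>octagon. qform (c, b, a) z \<le> 1)"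
  proof -
    have "qform (a, b, c) (x, y) = qform (c, b, a) (y, x)" for x y
      by (simp add: algebra_simps)
    then show ?thesis using octagon_swap by (metis surj_pair)
  qed
  moreover have "(c, a) \<in> region_A \<union> region_B \<union> region_C" using DE by (auto simp: region_swap)
  ultimately show ?thesis using qform_le_one_iff_ABC by simp
qed (rule qform_le_one_iff_ABC)

text \<open>The real supremum can be unfolded pointwise because the octagon is nonempty and the form
  is bounded on it by the sum of the absolute values of its coefficients.\<close>

lemma octagon_ball_iff: "p \<in> octagon_ball \<longleftrightarrow> (\<forall>z\<in>octagon. \<bar>qform p z\<bar> \<le> 1)"
proof -
  obtain a b c where p: "p = (a, b, c)" by (cases p)
  have "\<bar>qform p (x, y)\<bar> \<le> \<bar>a\<bar> + \<bar>b\<bar> + \<bar>c\<bar>" if "(x, y) \<in> octagon" for x y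
  proof -
    have "\<bar>u * v\<bar> \<le> \<bar>u\<bar>" if "0 \<le> v" "v \<le> 1" for u v :: real
      using mult_left_mono[OF that(2), of "\<bar>u\<bar>"] that by (simp add: abs_mult)
    moreover have "0 \<le> x * y" "x * y \<le> 1" "0 \<le> x\<^sup>2" "0 \<le> y\<^sup>2"
      using that by (auto simp: mem_octagon_iff mult_le_one)
    ultimately have "\<bar>a * x\<^sup>2\<bar> \<le> \<bar>a\<bar>" "\<bar>b * (x * y)\<bar> \<le> \<bar>b\<bar>" "\<bar>c * y\<^sup>2\<bar> \<le> \<bar>c\<bar>"
      using octagon_bounds[OF that] by blast+
    then show ?thesis by (simp add: p mult.assoc) linarith
  qed
  then have "bdd_above ((\<lambda>z. \<bar>qform p z\<bar>) ` octagon)" by (intro bdd_aboveI) auto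
  moreover have "octagon \<noteq> {}" using mem_octagon_iff[of 0 0] by auto
  ultimately show ?thesis by (simp add: octagon_ball_def octagon_norm_def cSUP_le_iff)
qed

lemma octagon_ball_iff_square:
  "(a, b, c) \<in> octagon_ball \<longleftrightarrow> (a, c) \<in> square \<and> G (a, c) \<le> b \<and> b \<le> F (a, c)"
proof (cases "(a, c) \<in> square")
  case True
  then have neg: "(- a, - c) \<in> square" by (simp add: mem_square_iff)
  have "qform (- a, - b, - c) z = - qform (a, b, c) z" for z by (cases z) simp
  then have "(a, b, c) \<in> octagon_ball \<longleftrightarrow>
      (\<forall>z\<in>octagon. qform (a, b, c) z \<le> 1) \<and> (\<forall>z\<in>octagon. qform (- a, - b, - c) z \<le> 1)"
    by (auto simp: octagon_ball_iff abs_le_iff)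
  also have "\<dots> \<longleftrightarrow> b \<le> F (a, c) \<and> - b \<le> F (- a, - c)"
    by (simp only: qform_le_one_iff[OF True] qform_le_one_iff[OF neg])
  finally show ?thesis using True by auto
next
  case False
  \<comment> \<open>At these two vertices the form takes the values \<open>a\<close> and
    \<open>c\<close>.\<close>
  have "(1, 0) \<in> octagon" "(0, 1) \<in> octagon" by (auto simp: mem_octagon_iff)
  then have "(a, c) \<in> square" if "(a, b, c) \<in> octagon_ball"
    using that by (force simp: octagon_ball_iff mem_square_iff abs_le_iff)
  with False show ?thesis by blast
qed

section \<open>Concavity and convexity\<close>

lemma convex_square: "convex square"
  unfolding square_def by (intro convex_Times) auto

text \<open>A convex combination of two extremal forms is still at most 1 on the octagon, so its
  middle coefficient cannot exceed \<open>F\<close> at the combined point.\<close>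

lemma concave_on_F: "concave_on square F"
  unfolding concave_on_iff
proof (intro conjI ballI allI impI convex_square)
  fix p q :: "real \<times> real" and u v :: real
  assume sq: "p \<in> square" "q \<in> square" and uv: "0 \<le> u" "0 \<le> v" "u + v = 1"
  obtain a c a' c' where pq: "p = (a, c)" "q = (a', c')" by (cases p, cases q)
  have comb: "u *\<^sub>R p + v *\<^sub>R q = (u * a + v * a', u * c + v * c')" by (simp add: pq)
  have "u *\<^sub>R p + v *\<^sub>R q \<in> square" using convexD[OF convex_square sq uv] .
  then have mem: "(u * a + v * a', u * c + v * c') \<in> square" by (simp only: comb)
  have "qform (u * a + v * a', u * F p + v * F q, u * c + v * c') z \<le> 1" if "z \<in> octagon" for z
  proof -
    have "qform (u * a + v * a', u * F p + v * F q, u * c + v * c') z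
        = u * qform (a, F p, c) z + v * qform (a', F q, c') z"
      by (cases z) (simp add: algebra_simps)
    also have "\<dots> \<le> u * 1 + v * 1"
      using sq uv that qform_le_one_iff[of a c "F p"] qform_le_one_iff[of a' c' "F q"]
      by (intro add_mono mult_left_mono) (auto simp: pq)
    finally show ?thesis using uv by simp
  qed
  then show "u * F p + v * F q \<le> F (u *\<^sub>R p + v *\<^sub>R q)"
    using qform_le_one_iff[OF mem] by (simp only: comb) blast
qed

lemma G_eq: "G p = - F (- p)"
  by (cases p) simp

lemma uminus_mem_square: "- p \<in> square \<longleftrightarrow> p \<in> square"
  by (cases p) (auto simp: mem_square_iff)

lemma convex_on_G: "convex_on square G"
  unfolding convex_on_def
proof (intro conjI ballI allI impI convex_square)
  fix p q :: "real \<times> real" and u v :: real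
  assume "p \<in> square" "q \<in> square" "0 \<le> u" "0 \<le> v" "u + v = 1"
  then have "u * F (- p) + v * F (- q) \<le> F (u *\<^sub>R (- p) + v *\<^sub>R (- q))"
    using concave_on_F uminus_mem_square unfolding concave_on_iff by blast
  then show "G (u *\<^sub>R p + v *\<^sub>R q) \<le> u * G p + v * G q"
    by (simp add: G_eq)
qed

section \<open>Continuity\<close>

lemma closed_regions:
  "closed region_A" "closed region_B" "closed region_C" "closed region_D" "closed region_E"
proof -
  have S: "closed square" unfolding square_def by (intro closed_Times) auto
  show "closed region_A" "closed region_B" "closed region_C" "closed region_D" "closed region_E"
    unfolding region_A_def region_B_def region_C_def region_D_def region_E_def case_prod_beta
    by (simp_all only: prod.collapse Collect_conj_eq Collect_mem_eq)
      (intro closed_Int S closed_Collect_le continuous_intros)+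
qed

text \<open>The five continuous formulas are pasted along the finite closed cover of the square;
  concavity alone does not ensure continuity at the boundary.\<close>

lemma continuous_on_F: "continuous_on square F"
proof -
  have A: "continuous_on region_A F"
    by (rule continuous_on_cong[THEN iffD2, OF refl, of _ _
          "\<lambda>p. 2 * sqrt (- fst p * (1 - snd p))"]) (auto simp: F_eqs intro!: continuous_intros)
  have B: "continuous_on region_B F"
    by (rule continuous_on_cong[THEN iffD2, OF refl, of _ _
          "\<lambda>p. (1 - snd p) / tau - tau * fst p"])
      (use tau_pos in \<open>auto simp: F_eqs intro!: continuous_intros\<close>)
  have C: "continuous_on region_C F"
    by (rule continuous_on_cong[THEN iffD2, OF refl, of _ _
          "\<lambda>p. 1 + sqrt ((1 - 2 * fst p) * (1 - 2 * snd p))"])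
      (auto simp: F_eqs intro!: continuous_intros)
  have D: "continuous_on region_D F"
    by (rule continuous_on_cong[THEN iffD2, OF refl, of _ _
          "\<lambda>p. (1 - fst p) / tau - tau * snd p"])
      (use tau_pos in \<open>auto simp: F_eqs intro!: continuous_intros\<close>)
  have E: "continuous_on region_E F"
    by (rule continuous_on_cong[THEN iffD2, OF refl, of _ _
          "\<lambda>p. 2 * sqrt (- snd p * (1 - fst p))"]) (auto simp: F_eqs intro!: continuous_intros)
  show ?thesis
    unfolding regions_cover
    by (intro continuous_on_closed_Un closed_Un closed_regions A B C D E)
qed

lemma continuous_on_G: "continuous_on square G"
proof -
  have "continuous_on square (\<lambda>p. - F (- p))"
    by (intro continuous_on_minus continuous_on_compose2[OF continuous_on_F])
      (auto simp only: uminus_mem_square intro!: continuous_on_minus continuous_on_id)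
  then show ?thesis by (simp add: G_eq cong: continuous_on_cong)
qed

theorem corollary3p2:
  shows "(\<forall>a b c. (a, b, c) \<in> octagon_ball \<longleftrightarrow>
            (a, c) \<in> square \<and> G (a, c) \<le> b \<and> b \<le> F (a, c))
         \<and> concave_on square F \<and> convex_on square G
         \<and> continuous_on square F \<and> continuous_on square G"
  using octagon_ball_iff_square concave_on_F convex_on_G continuous_on_F continuous_on_G by blast

end
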